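(* Let $k,\ell\geq 1$ be integers and let $\mathbb{C}_{k,\ell}$ denote the set of cyclic permutations of $\{1,\ldots,(k-1)(\ell-1)+1\}$ that contain no increasing cyclic sub-permutation of length $k+1$ and no decreasing cyclic sub-permutation of length $\ell+1$. Then: (1) If $\min(k,\ell)\le 2$, then $|\mathbb{C}_{k,\ell}|=1$, and its single element is the decreasing cyclic permutation when $k\le 2$ and the increasing cyclic permutation when $k\ge 3$. (2) If $\min(k,\ell)\ge 3$, then $|\mathbb{C}_{k,\ell}|=2$, and a cyclic permutation $(1,a_1,\ldots,a_{(k-1)(\ell-1)})$ of $\{1,\ldots,(k-1)(\ell-1)+1\}$ belongs to $\mathbb{C}_{k,\ell}$ if and only if the sequence $a_1,\ldots,a_{(k-1)(\ell-1)}$ satisfies one of the following: (i) for each $(i,j)\in\{1,\ldots,\ell-1\}\times\{1,\ldots,k-1\}$, $a_{(j-1)(\ell-1)+i}=(\ell-1-i)(k-1)+j+1$; (ii) for each $(i,j)\in\{1,\ldots,\ell-1\}\times\{1,\ldots,k-1\}$, $a_{(i-1)(k-1)+j}=(j-1)(\ell-1)+(\ell-i)+1$.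
   Context: A cyclic permutation of a finite set of distinct integers is an arrangement of its elements in a circle, written $(j_1,\ldots,j_n)$, where two such expressions denote the same cyclic permutation if one is a cyclic rotation of the other; its length is $n$. Every cyclic permutation of $\{1,\ldots,N\}$ can be written uniquely starting with $1$. A cyclic sub-permutation of $\sigma$ is obtained by deleting some elements of $\sigma$ and keeping the rest in their cyclic order. A cyclic permutation is increasing if it can be written as $(j_1,\ldots,j_n)$ with $j_1<\cdots<j_n$, and decreasing if it can be written as $(j_1,\ldots,j_n)$ with $j_1>\cdots>j_n$. *)

theory Defs
  imports Main "HOL-Library.Sublist"
begin

definition rotation_of :: "'a list \<Rightarrow> 'a list \<Rightarrow> bool" where
  "rotation_of xs ys \<longleftrightarrow> (\<exists>n. ys = rotate n xs)"

lemma equivp_rotation_of: "equivp (rotation_of :: 'a list \<Rightarrow> _)"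
proof (rule equivpI)
  show "reflp (rotation_of :: 'a list \<Rightarrow> _)"
    by (rule reflpI) (metis rotation_of_def rotate0 id_apply)
  show "symp (rotation_of :: 'a list \<Rightarrow> _)"
  proof (rule sympI)
    fix xs ys :: "'a list"
    assume "rotation_of xs ys"
    then obtain n where ys: "ys = rotate n xs"
      by (auto simp: rotation_of_def)
    have "rotate (length xs - n mod length xs) ys = xs"
    proof (cases "xs = []")
      case False
      then have "n mod length xs \<le> length xs"
        by (simp add: less_imp_le)
      then show ?thesis
        by (metis ys rotate_rotate rotate_conv_mod le_add_diff_inverse2 rotate_id mod_self)
    qed (simp add: ys)
    then show "rotation_of ys xs"
      by (metis rotation_of_def)
  qed
  show "transp (rotation_of :: 'a list \<Rightarrow> _)"
    by (rule transpI) (auto simp: rotation_of_def rotate_rotate)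
qed

text \<open>Circular arrangements: lists up to rotation. The constructor \<open>Cyc\<close> sends the list
  \<open>[j\<^sub>1, \<dots>, j\<^sub>n]\<close> to the arrangement \<open>(j\<^sub>1, \<dots>, j\<^sub>n)\<close>.\<close>

quotient_type 'a cyc = "'a list" / rotation_of
  morphisms Rep_cyc Cyc
  by (rule equivp_rotation_of)

lift_definition cyc_length :: "'a cyc \<Rightarrow> nat" is length
  by (auto simp: rotation_of_def)

lift_definition cyc_set :: "'a cyc \<Rightarrow> 'a set" is set
  by (auto simp: rotation_of_def)

lift_definition cyc_distinct :: "'a cyc \<Rightarrow> bool" is distinct
  by (auto simp: rotation_of_def)

definition cyclic_perms :: "'a set \<Rightarrow> 'a cyc set" where
  "cyclic_perms A = {\<sigma>. cyc_distinct \<sigma> \<and> cyc_set \<sigma> = A}"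

definition cyclic_sub :: "'a cyc \<Rightarrow> 'a cyc \<Rightarrow> bool" where
  "cyclic_sub \<tau> \<sigma> \<longleftrightarrow> (\<exists>ys xs. \<tau> = Cyc ys \<and> \<sigma> = Cyc xs \<and> subseq ys xs)"

definition cyc_increasing :: "'a::linorder cyc \<Rightarrow> bool" where
  "cyc_increasing \<sigma> \<longleftrightarrow> (\<exists>xs. \<sigma> = Cyc xs \<and> sorted_wrt (<) xs)"

definition cyc_decreasing :: "'a::linorder cyc \<Rightarrow> bool" where
  "cyc_decreasing \<sigma> \<longleftrightarrow> (\<exists>xs. \<sigma> = Cyc xs \<and> sorted_wrt (>) xs)"

definition CC :: "nat \<Rightarrow> nat \<Rightarrow> nat cyc set" where
  "CC k l = {\<sigma> \<in> cyclic_perms {1..(k - 1) * (l - 1) + 1}.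
     \<not> (\<exists>\<tau>. cyclic_sub \<tau> \<sigma> \<and> cyc_increasing \<tau> \<and> cyc_length \<tau> = k + 1) \<and>
     \<not> (\<exists>\<tau>. cyclic_sub \<tau> \<sigma> \<and> cyc_decreasing \<tau> \<and> cyc_length \<tau> = l + 1)}"

end

theory Submission imports Defs begin

text \<open>
  Put \<open>m = k - 1\<close>, \<open>n = l - 1\<close>, \<open>N = m n + 1\<close>, and view a cyclic permutation as a set of \<open>N\<close> points on the
  torus, one in each row and each column. Both forbidden patterns are invariant under rotating positions
  and rotating values, so every point may serve as the origin. Seen from an origin, the remaining
  \<open>m n\<close> points have no increasing chain of length \<open>m + 1\<close> and no decreasing chain of length \<open>n + 1\<close>; this is the
  extremal case of Erdos--Szekeres, in which the pairs (increasing rank, decreasing rank) fill the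
  grid \<open>{1..m} \<times> {1..n}\<close> exactly. Comparing the grids seen from two consecutive points \<open>O\<close>, \<open>Q\<close> shows that the
  step from \<open>O\<close> to \<open>Q\<close> is \<open>n\<close> or \<open>-m\<close> modulo \<open>N\<close>, according to whether the point preceding \<open>O\<close> lies above or
  below \<open>Q\<close>. Going from a step \<open>n\<close> to a step \<open>-m\<close> forces \<open>m < n\<close>, and the other change forces \<open>n < m\<close>, so around
  the circle the step is constant and the arrangement is \<open>p \<mapsto> n p\<close> or \<open>p \<mapsto> -m p\<close> modulo \<open>N\<close>.
  Conversely, on each of these two lattices a linear form with coefficient sum \<open>k\<close> (respectively \<open>l\<close>) takes
  positive multiples of \<open>N\<close> on all increasing (respectively decreasing) steps, which bounds the chains.
\<close>

subsection \<open>Extremal Erdos--Szekeres labellings\<close>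

lemma chain_rank_exists:
  fixes R :: "'a \<Rightarrow> 'a \<Rightarrow> bool"
  assumes "finite A" "transp_on A R" "irreflp_on A R"
    and card_chain: "\<And>S. \<lbrakk>S \<subseteq> A; totalp_on S R\<rbrakk> \<Longrightarrow> card S \<le> K"
  obtains r :: "'a \<Rightarrow> nat" where "\<And>x. x \<in> A \<Longrightarrow> r x \<in> {1..K}"
    and "\<And>x y. \<lbrakk>x \<in> A; y \<in> A; R x y\<rbrakk> \<Longrightarrow> r x < r y"
proof -
  define chains_to where
    "chains_to x = {S. S \<subseteq> A \<and> totalp_on S R \<and> x \<in> S \<and> (\<forall>y\<in>S. y \<noteq> x \<longrightarrow> R y x)}" for x
  define r where "r x = Max (card ` chains_to x)" for x
  have fin: "finite (card ` chains_to x)" for x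
    using \<open>finite A\<close> by (auto simp: chains_to_def intro!: finite_imageI finite_subset[of _ "Pow A"])
  have card_le_r: "card S \<le> r x" if "S \<in> chains_to x" for S x
    unfolding r_def using fin that by (intro Max_ge) auto
  have singleton: "{x} \<in> chains_to x" if "x \<in> A" for x
    using that by (simp add: chains_to_def)
  have longest: "\<exists>S\<in>chains_to x. card S = r x" if "x \<in> A" for x
  proof -
    have "r x \<in> card ` chains_to x"
      unfolding r_def using fin singleton[OF that] by (intro Max_in) auto
    then show ?thesis by auto
  qed
  show thesis
  proof
    fix x assume x: "x \<in> A"
    obtain S where "S \<in> chains_to x" "card S = r x" using longest[OF x] by blast
    then have "r x \<le> K" using card_chain[of S] by (simp add: chains_to_def)
    moreover have "1 \<le> r x" using card_le_r[OF singleton[OF x]] by simp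
    ultimately show "r x \<in> {1..K}" by simp
  next
    fix x y assume xy: "x \<in> A" "y \<in> A" "R x y"
    obtain S where S: "S \<in> chains_to x" "card S = r x" using longest xy(1) by blast
    have below_y: "R z y" if "z \<in> S" for z
      using that S(1) xy transp_onD[OF assms(2), of z x y] by (cases "z = x") (auto simp: chains_to_def)
    then have "y \<notin> S" using irreflp_onD[OF assms(3)] xy(2) by blast
    moreover have "finite S" using S(1) \<open>finite A\<close> by (auto simp: chains_to_def intro: finite_subset)
    moreover have "insert y S \<in> chains_to y"
      using S(1) xy below_y by (auto simp: chains_to_def totalp_on_def)
    ultimately show "r x < r y" using card_le_r[of "insert y S" y] S(2) by simp
  qed
qed

lemma monotone_rank_exists:
  fixes A :: "'a::linorder set" and c :: "'a \<Rightarrow> 'b"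
  assumes "finite A" "transp R"
    and card_monotone: "\<And>S. \<lbrakk>S \<subseteq> A; monotone_on S (<) R c\<rbrakk> \<Longrightarrow> card S \<le> K"
  obtains r :: "'a \<Rightarrow> nat" where "\<And>i. i \<in> A \<Longrightarrow> r i \<in> {1..K}"
    and "\<And>i j. \<lbrakk>i \<in> A; j \<in> A; i < j; R (c i) (c j)\<rbrakk> \<Longrightarrow> r i < r j"
proof -
  let ?R = "\<lambda>i j. i < j \<and> R (c i) (c j)"
  have "card S \<le> K" if "S \<subseteq> A" "totalp_on S ?R" for S
    using that by (intro card_monotone monotone_onI) (force simp: totalp_on_def)+
  moreover have "transp_on A ?R" "irreflp_on A ?R"
    using \<open>transp R\<close> by (auto intro!: transp_onI irreflp_onI dest: transpD)
  ultimately obtain r where "\<And>i. i \<in> A \<Longrightarrow> r i \<in> {1..K}"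
    "\<And>i j. \<lbrakk>i \<in> A; j \<in> A; ?R i j\<rbrakk> \<Longrightarrow> r i < r j"
    using chain_rank_exists[OF \<open>finite A\<close>, of ?R K] by auto
  then show thesis using that[of r] by simp
qed

locale erdos_szekeres_labelling =
  fixes A :: "'a::linorder set" and c :: "'a \<Rightarrow> 'b::linorder" and m n :: nat and f g :: "'a \<Rightarrow> nat"
  assumes finite_A: "finite A" and card_A: "card A = m * n" and inj_c: "inj_on c A"
    and f_range: "i \<in> A \<Longrightarrow> f i \<in> {1..m}"
    and g_range: "i \<in> A \<Longrightarrow> g i \<in> {1..n}"
    and f_less: "\<lbrakk>i \<in> A; j \<in> A; i < j; c i < c j\<rbrakk> \<Longrightarrow> f i < f j"
    and g_less: "\<lbrakk>i \<in> A; j \<in> A; i < j; c j < c i\<rbrakk> \<Longrightarrow> g i < g j"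
begin

lemma f_or_g_less:
  assumes "i \<in> A" "j \<in> A" "i < j"
  shows "c i < c j \<and> f i < f j \<or> c j < c i \<and> g i < g j"
  using assms f_less g_less inj_onD[OF inj_c, of i j] by (cases "c i" "c j" rule: linorder_cases) auto

lemma column_less:
  assumes "i \<in> A" "j \<in> A" "f i = f j" "i < j"
  shows "c j < c i" "g i < g j"
  using f_or_g_less[of i j] assms by auto

lemma row_less:
  assumes "i \<in> A" "j \<in> A" "g i = g j" "i < j"
  shows "c i < c j" "f i < f j"
  using f_or_g_less[of i j] assms by auto

lemma bij_betw_labels: "bij_betw (\<lambda>i. (f i, g i)) A ({1..m} \<times> {1..n})"
proof -
  have inj: "inj_on (\<lambda>i. (f i, g i)) A"
    by (rule linorder_inj_onI') (use f_or_g_less in fastforce)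
  moreover have "(\<lambda>i. (f i, g i)) ` A = {1..m} \<times> {1..n}"
    by (rule card_subset_eq) (use f_range g_range card_image[OF inj] card_A in auto)
  ultimately show ?thesis by (simp add: bij_betw_def)
qed

lemma label_surj:
  assumes "a \<in> {1..m}" "b \<in> {1..n}"
  obtains i where "i \<in> A" "f i = a" "g i = b"
proof -
  have "(a, b) \<in> (\<lambda>i. (f i, g i)) ` A"
    using bij_betw_labels assms by (simp add: bij_betw_def)
  then show thesis using that by auto
qed

lemma card_column:
  assumes "a \<in> {1..m}"
  shows "card {i \<in> A. f i = a} = n"
proof -
  have "bij_betw (\<lambda>i. (f i, g i)) {i \<in> A. f i = a} {x \<in> {1..m} \<times> {1..n}. fst x = a}"
    by (rule bij_betw_Collect[OF bij_betw_labels]) simp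
  also have "{x \<in> {1..m} \<times> {1..n}. fst x = a} = {a} \<times> {1..n}" using assms by auto
  finally show ?thesis by (simp add: bij_betw_same_card)
qed

lemma card_row:
  assumes "b \<in> {1..n}"
  shows "card {i \<in> A. g i = b} = m"
proof -
  have "bij_betw (\<lambda>i. (f i, g i)) {i \<in> A. g i = b} {x \<in> {1..m} \<times> {1..n}. snd x = b}"
    by (rule bij_betw_Collect[OF bij_betw_labels]) simp
  also have "{x \<in> {1..m} \<times> {1..n}. snd x = b} = {1..m} \<times> {b}" using assms by auto
  finally show ?thesis by (simp add: bij_betw_same_card)
qed

lemma first_label:
  assumes i: "i \<in> A" and first: "\<And>j. j \<in> A \<Longrightarrow> i \<le> j"
  shows "f i = 1" "g i = 1"
proof -
  have "1 \<in> {1..m}" "1 \<in> {1..n}" using f_range[OF i] g_range[OF i] by auto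
  then obtain j where j: "j \<in> A" "f j = 1" "g j = 1" using label_surj by blast
  have "\<not> i < j" using f_or_g_less[OF i j(1)] j(2,3) f_range[OF i] g_range[OF i] by auto
  then have "i = j" using first[OF j(1)] by simp
  then show "f i = 1" "g i = 1" using j by auto
qed

lemma last_label:
  assumes i: "i \<in> A" and last: "\<And>j. j \<in> A \<Longrightarrow> j \<le> i"
  shows "f i = m" "g i = n"
proof -
  have "m \<in> {1..m}" "n \<in> {1..n}" using f_range[OF i] g_range[OF i] by auto
  then obtain j where j: "j \<in> A" "f j = m" "g j = n" using label_surj by blast
  have "\<not> j < i" using f_or_g_less[OF j(1) i] j(2,3) f_range[OF i] g_range[OF i] by auto
  then have "j = i" using last[OF j(1)] by simp
  then show "f i = m" "g i = n" using j by auto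
qed

lemma n_le_card_below_first:
  assumes i: "i \<in> A" and first: "\<And>j. j \<in> A \<Longrightarrow> i \<le> j"
  shows "n \<le> card {j \<in> A. c j \<le> c i}"
proof -
  have "c j \<le> c i" if "j \<in> A" "f j = f i" for j
    using column_less(1)[OF i that(1)] first[OF that(1)] that(2) by (cases "j = i") (auto simp: less_imp_le)
  then have "{j \<in> A. f j = f i} \<subseteq> {j \<in> A. c j \<le> c i}" by blast
  then show ?thesis
    using card_column[OF f_range[OF i]] card_mono[of "{j \<in> A. c j \<le> c i}"] finite_A by auto
qed

end

lemma erdos_szekeres_labelling_exists:
  fixes A :: "'a::linorder set" and c :: "'a \<Rightarrow> 'b::linorder"
  assumes "finite A" "card A = m * n" "inj_on c A"
    and mono: "\<And>S. \<lbrakk>S \<subseteq> A; strict_mono_on S c\<rbrakk> \<Longrightarrow> card S \<le> m"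
    and antimono: "\<And>S. \<lbrakk>S \<subseteq> A; strict_antimono_on S c\<rbrakk> \<Longrightarrow> card S \<le> n"
  shows "\<exists>f g. erdos_szekeres_labelling A c m n f g"
proof -
  obtain f where f: "\<And>i. i \<in> A \<Longrightarrow> f i \<in> {1..m}"
    "\<And>i j. \<lbrakk>i \<in> A; j \<in> A; i < j; c i < c j\<rbrakk> \<Longrightarrow> f i < f j"
    using monotone_rank_exists[OF \<open>finite A\<close> transp_on_less mono] by blast
  obtain g where g: "\<And>i. i \<in> A \<Longrightarrow> g i \<in> {1..n}"
    "\<And>i j. \<lbrakk>i \<in> A; j \<in> A; i < j; c j < c i\<rbrakk> \<Longrightarrow> g i < g j"
    using monotone_rank_exists[OF \<open>finite A\<close> transp_on_greater antimono] by blast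
  have "erdos_szekeres_labelling A c m n f g"
    by unfold_locales (use assms(1-3) f g in \<open>simp_all del: atLeastAtMost_iff\<close>)
  then show ?thesis by blast
qed

subsection \<open>Arrangements on the torus\<close>

lemma mod_eq_if_abs_less:
  fixes x N :: int
  assumes "\<bar>x\<bar> < N"
  shows "x mod N = (if 0 \<le> x then x else x + N)"
proof (cases "0 \<le> x")
  case False
  have "x mod N = x + N" by (rule int_mod_pos_eq[of _ _ "- 1"]) (use False assms in auto)
  then show ?thesis using False by simp
qed (use assms in simp)

definition rise :: "nat \<Rightarrow> (nat \<Rightarrow> int) \<Rightarrow> nat \<Rightarrow> nat \<Rightarrow> int" where
  "rise N h p i = (h i - h p) mod int N"

locale cyclic_arrangement =
  fixes N :: nat and h :: "nat \<Rightarrow> int"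
  assumes N_pos: "0 < N"
    and periodic: "h (i + N) = h i"
    and incongruent: "\<lbrakk>i < j; j < i + N\<rbrakk> \<Longrightarrow> h i mod int N \<noteq> h j mod int N"
begin

abbreviation frame :: "nat \<Rightarrow> nat set" where
  "frame p \<equiv> {p<..<p + N}"

abbreviation step :: "nat \<Rightarrow> int" where
  "step p \<equiv> rise N h p (Suc p)"

lemma rise_nonneg: "0 \<le> rise N h p i" and rise_less: "rise N h p i < int N"
  using N_pos by (simp_all add: rise_def)

lemma rise_pos:
  assumes "i \<in> frame p"
  shows "0 < rise N h p i"
proof -
  have "rise N h p i \<noteq> 0"
    using incongruent[of p i] assms by (auto simp: rise_def simp flip: mod_eq_dvd_iff dvd_eq_mod_eq_0)
  then show ?thesis using rise_nonneg[of p i] by simp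
qed

lemma inj_on_rise: "inj_on (rise N h p) (frame p)"
proof (rule linorder_inj_onI')
  fix i j assume "i \<in> frame p" "j \<in> frame p" "i < j"
  then have "h i mod int N \<noteq> h j mod int N" by (intro incongruent) auto
  then show "rise N h p i \<noteq> rise N h p j" by (simp add: rise_def mod_eq_dvd_iff)
qed

lemma bij_betw_rise: "bij_betw (rise N h p) (frame p) {0<..<int N}"
  unfolding bij_betw_def
proof
  show "rise N h p ` frame p = {0<..<int N}"
    by (rule card_subset_eq) (use rise_pos rise_less card_image[OF inj_on_rise] in auto)
qed (rule inj_on_rise)

lemma card_rise_le:
  assumes "0 \<le> v" "v < int N"
  shows "int (card {i \<in> frame p. rise N h p i \<le> v}) = v"
proof -
  have "bij_betw (rise N h p) {i \<in> frame p. rise N h p i \<le> v} {x \<in> {0<..<int N}. x \<le> v}"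
    by (rule bij_betw_Collect[OF bij_betw_rise]) simp
  also have "{x \<in> {0<..<int N}. x \<le> v} = {0<..v}" using assms(2) by auto
  finally show ?thesis using assms(1) by (simp add: bij_betw_same_card)
qed

lemma rise_trans: "rise N h p j = (rise N h p i + rise N h i j) mod int N"
  by (simp add: rise_def mod_add_eq)

lemma rise_eq_diff:
  "rise N h q i = (if rise N h p q \<le> rise N h p i then rise N h p i - rise N h p q
    else rise N h p i - rise N h p q + int N)"
proof -
  have "rise N h q i = (rise N h p i - rise N h p q) mod int N" by (simp add: rise_def mod_diff_eq)
  also have "\<bar>rise N h p i - rise N h p q\<bar> < int N"
    using rise_nonneg[of p i] rise_less[of p i] rise_nonneg[of p q] rise_less[of p q] by linarith
  then have "(rise N h p i - rise N h p q) mod int N = (if rise N h p q \<le> rise N h p i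
      then rise N h p i - rise N h p q else rise N h p i - rise N h p q + int N)"
    by (simp add: mod_eq_if_abs_less)
  finally show ?thesis .
qed

lemma rise_eq_mult:
  assumes "\<And>p. step p = d mod int N"
  shows "rise N h 0 i = d * int i mod int N"
proof (induction i)
  case (Suc i)
  have "rise N h 0 (Suc i) = (rise N h 0 i + step i) mod int N" by (rule rise_trans)
  also have "\<dots> = (d * int i + d) mod int N" unfolding Suc.IH assms by (rule mod_add_eq)
  finally show ?case by (simp add: distrib_left add.commute)
qed (simp add: rise_def)

lemma periodic_mult: "h (i + t * N) = h i"
proof (induction t)
  case (Suc t)
  then show ?case using periodic[of "i + t * N"] by (simp add: add_ac)
qed simp

lemma rise_cong_period: "rise N h (p + t * N) (i + t * N) = rise N h p i"
  by (simp add: rise_def periodic_mult)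

lemma rise_period: "rise N h p (i + N) = rise N h p i"
  by (simp add: rise_def periodic)

lemma rise_reverse:
  assumes "q \<in> frame p"
  shows "rise N h q (p + N) = int N - rise N h p q"
proof -
  have "rise N h p p = 0" by (simp add: rise_def)
  then show ?thesis using rise_eq_diff[of q p p] rise_pos[OF assms] by (simp add: rise_period)
qed

lemma rise_uminus:
  assumes "i \<in> frame p"
  shows "rise N (\<lambda>i. - h i) p i = int N - rise N h p i"
proof -
  have "rise N (\<lambda>i. - h i) p i = (- (h i - h p)) mod int N" by (simp add: rise_def)
  then show ?thesis
    using rise_pos[OF assms] unfolding zmod_zminus1_eq_if by (simp add: rise_def)
qed

lemma cyclic_arrangement_uminus: "cyclic_arrangement N (\<lambda>i. - h i)"
proof
  show "- h i mod int N \<noteq> - h j mod int N" if "i < j" "j < i + N" for i j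
    using incongruent[OF that] mod_minus_cong[of "- h i" "int N" "- h j"] by auto
qed (simp_all add: N_pos periodic)

end

locale extremal_arrangement = cyclic_arrangement +
  fixes m n :: nat
  assumes N_eq: "N = m * n + 1"
    and card_increasing: "\<lbrakk>S \<subseteq> frame p; strict_mono_on S (rise N h p)\<rbrakk> \<Longrightarrow> card S \<le> m"
    and card_decreasing: "\<lbrakk>S \<subseteq> frame p; strict_antimono_on S (rise N h p)\<rbrakk> \<Longrightarrow> card S \<le> n"
begin

lemma labelling_exists: "\<exists>f g. erdos_szekeres_labelling (frame p) (rise N h p) m n f g"
  using inj_on_rise card_increasing card_decreasing N_eq by (intro erdos_szekeres_labelling_exists) auto

lemma extremal_arrangement_uminus: "extremal_arrangement N (\<lambda>i. - h i) n m"
proof -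
  interpret U: cyclic_arrangement N "\<lambda>i. - h i" by (rule cyclic_arrangement_uminus)
  show ?thesis
  proof
    fix S p assume S: "S \<subseteq> frame p"
    then have rise_S: "rise N (\<lambda>i. - h i) p i = int N - rise N h p i" if "i \<in> S" for i
      using that by (intro rise_uminus) auto
    show "card S \<le> n" if "strict_mono_on S (rise N (\<lambda>i. - h i) p)"
      using that by (intro card_decreasing[OF S]) (simp add: monotone_on_def rise_S)
    show "card S \<le> m" if "strict_antimono_on S (rise N (\<lambda>i. - h i) p)"
      using that by (intro card_increasing[OF S]) (simp add: monotone_on_def rise_S)
  qed (simp add: N_eq)
qed

lemma next_and_last_mem:
  assumes "2 \<le> m * n"
  shows "Suc p \<in> frame p" "p + m * n \<in> frame p"
  unfolding greaterThanLessThan_iff N_eq using assms by linarith+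

lemma step_ge:
  assumes "0 < m * n"
  shows "int n \<le> step p"
proof -
  obtain f g where "erdos_szekeres_labelling (frame p) (rise N h p) m n f g"
    using labelling_exists by blast
  then interpret erdos_szekeres_labelling "frame p" "rise N h p" m n f g .
  have "n \<le> card {i \<in> frame p. rise N h p i \<le> step p}"
    using assms by (intro n_le_card_below_first) (auto simp: N_eq)
  then show ?thesis using card_rise_le[OF rise_nonneg rise_less, of p p "Suc p"] by linarith
qed

end

lemma card_le_if_strict_mono_on:
  fixes \<phi> :: "'a::linorder \<Rightarrow> nat"
  assumes "strict_mono_on S \<phi>" "\<And>i. i \<in> S \<Longrightarrow> \<phi> i \<in> {a..b}"
  shows "card S \<le> b + 1 - a"
proof -
  have "card S \<le> card {a..b}"
    using strict_mono_on_imp_inj_on[OF assms(1)] assms(2) by (intro card_inj_on_le[of \<phi>]) auto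
  then show ?thesis by simp
qed

text \<open>
  Let \<open>O\<close> and \<open>Q\<close> be the points at \<open>p\<close> and \<open>p + 1\<close>, with labellings \<open>(f, g)\<close> and \<open>(f', g')\<close>. If the last point
  before \<open>O\<close> lies above \<open>Q\<close>, then so do the column \<open>f = m\<close> and the rest of the row \<open>g = 1\<close>; both chains survive
  in the frame of \<open>Q\<close>, so that their common point has \<open>g' = 1\<close> and \<open>f' \<ge> m - 1\<close>. This pushes every point
  below \<open>Q\<close> into the column \<open>f' = m\<close>, which has only \<open>n\<close> points.
\<close>

locale consecutive_labellings =
  extremal_arrangement N h m n +
  O: erdos_szekeres_labelling "{p<..<p + N}" "rise N h p" m n f g +
  Q: erdos_szekeres_labelling "{Suc p<..<Suc p + N}" "rise N h (Suc p)" m n f' g'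
  for N h m n p f g f' g' +
  assumes step_below_last: "step p < rise N h p (p + m * n)"
begin

lemma labels_pos: "0 < m" "0 < n" "2 \<le> m * n"
proof -
  have "rise N h p p = 0" by (simp add: rise_def)
  then have "p + m * n \<noteq> p" "p + m * n \<noteq> Suc p"
    using step_below_last rise_nonneg[of p "Suc p"] by (metis leD, force)
  then show "2 \<le> m * n" by linarith
  then show "0 < m" "0 < n" by (metis gr0I mult_0 mult_0_right not_numeral_le_zero)+
qed

lemmas next_mem = next_and_last_mem(1)[OF labels_pos(3), of p]
  and last_mem = next_and_last_mem(2)[OF labels_pos(3), of p]

lemma base_mem: "p + N \<in> frame (Suc p)"
  unfolding greaterThanLessThan_iff N_eq using labels_pos(3) by linarith

lemma next_in_first_row: "g (Suc p) = 1"
  using O.first_label(2)[OF next_mem] by auto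

lemma last_in_last_column: "f (p + m * n) = m"
  using O.last_label(1)[OF last_mem] N_eq by auto

lemma base_in_last_column: "f' (p + N) = m"
  using Q.last_label(1)[OF base_mem] by auto

lemma mem_next_frame:
  assumes "i \<in> frame p" "i \<noteq> Suc p"
  shows "i \<in> frame (Suc p)"
  using assms by auto

lemma rise_next_mono:
  assumes "step p \<le> rise N h p i" "rise N h p i < rise N h p j"
  shows "rise N h (Suc p) i < rise N h (Suc p) j"
  using assms rise_eq_diff[of "Suc p" _ p] by simp

lemma last_column_above:
  assumes "i \<in> frame p" "f i = m"
  shows "step p < rise N h p i"
proof (cases "i = p + m * n")
  case False
  then have "i < p + m * n" using assms(1) N_eq by simp
  then have "rise N h p (p + m * n) < rise N h p i"
    using O.column_less(1)[OF assms(1) last_mem] assms(2) last_in_last_column by simp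
  then show ?thesis using step_below_last by simp
qed (use step_below_last in simp)

lemma first_row_above:
  assumes "i \<in> frame p" "g i = 1" "i \<noteq> Suc p"
  shows "step p < rise N h p i"
  using O.row_less(1)[OF next_mem assms(1)] assms next_in_first_row by simp

lemma corner_in_next_first_row:
  assumes e: "e \<in> frame p" "f e = m" "g e = 1"
  shows "g' e = 1"
proof -
  let ?C = "{i \<in> frame p. f i = m}"
  have next_frame: "i \<in> frame (Suc p)" if "i \<in> ?C" for i
    using that last_column_above[of i] by (intro mem_next_frame) auto
  have mono: "strict_mono_on ?C g'"
  proof (rule strict_mono_onI)
    fix i j assume ij: "i \<in> ?C" "j \<in> ?C" "i < j"
    then have "rise N h p j < rise N h p i" using O.column_less(1)[of i j] by simp
    then have "rise N h (Suc p) j < rise N h (Suc p) i"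
      using last_column_above[of j] ij by (intro rise_next_mono) auto
    then show "g' i < g' j" using next_frame ij by (intro Q.g_less) auto
  qed
  have first: "e \<le> i" if "i \<in> ?C" for i
    using that O.column_less(2)[of i e] e O.g_range[of i] by (cases "i < e") auto
  have "e \<in> ?C" using e by simp
  then have "g' i \<in> {g' e..n}" if "i \<in> ?C" for i
    using strict_mono_on_leD[OF mono _ that first[OF that]] Q.g_range[OF next_frame[OF that]] by simp
  then have "card ?C \<le> n + 1 - g' e" by (rule card_le_if_strict_mono_on[OF mono])
  then have "n \<le> n + 1 - g' e" using O.card_column[of m] labels_pos by simp
  then show ?thesis using Q.g_range[OF next_frame[of e]] e by auto
qed

lemma corner_next_column_ge:
  assumes e: "e \<in> frame p" "f e = m" "g e = 1"
  shows "m - 1 \<le> f' e"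
proof -
  let ?R = "{i \<in> frame p. g i = 1} - {Suc p}"
  have next_frame: "i \<in> frame (Suc p)" if "i \<in> ?R" for i
    using that by (intro mem_next_frame) auto
  have mono: "strict_mono_on ?R f'"
  proof (rule strict_mono_onI)
    fix i j assume ij: "i \<in> ?R" "j \<in> ?R" "i < j"
    then have "rise N h p i < rise N h p j" using O.row_less(1)[of i j] by simp
    then have "rise N h (Suc p) i < rise N h (Suc p) j"
      using first_row_above[of i] ij by (intro rise_next_mono) auto
    then show "f' i < f' j" using next_frame ij by (intro Q.f_less) auto
  qed
  have last: "i \<le> e" if "i \<in> ?R" for i
    using that O.row_less(2)[of e i] e O.f_range[of i] by (cases "e < i") auto
  have "e \<in> ?R" using e last_column_above[of e] by auto
  then have "f' i \<in> {1..f' e}" if "i \<in> ?R" for i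
    using strict_mono_on_leD[OF mono that _ last[OF that]] Q.f_range[OF next_frame[OF that]] by simp
  then have "card ?R \<le> f' e + 1 - 1" by (rule card_le_if_strict_mono_on[OF mono])
  then show ?thesis using O.card_row[of 1] labels_pos next_mem next_in_first_row by simp
qed

lemma above_base_imp_last_column:
  assumes i: "i \<in> frame (Suc p)" "int N - step p < rise N h (Suc p) i"
  shows "f' i = m"
proof (rule ccontr)
  assume "f' i \<noteq> m"
  then have f'_i: "f' i \<in> {1..m}" "f' i < m" using Q.f_range[OF i(1)] by auto
  obtain e where e: "e \<in> frame p" "f e = m" "g e = 1"
    using labels_pos by (auto intro: O.label_surj[of m 1])
  then have e': "e \<in> frame (Suc p)" using last_column_above[of e] by (intro mem_next_frame) auto
  obtain q where q: "q \<in> frame (Suc p)" "f' q = f' i" "g' q = 1"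
    using f'_i labels_pos by (auto intro: Q.label_surj[of "f' i" 1])
  have "q \<le> e"
    using Q.row_less(2)[OF e' q(1)] corner_in_next_first_row[OF e] corner_next_column_ge[OF e] q f'_i
    by (cases "e < q") auto
  then have "rise N h (Suc p) q \<le> rise N h (Suc p) e"
    using Q.row_less(1)[OF q(1) e'] corner_in_next_first_row[OF e] q(3) by (cases "q = e") auto
  also have "\<dots> < int N - step p"
    using rise_eq_diff[of "Suc p" e p] last_column_above[of e] e rise_less[of p e] by simp
  finally have q_below_i: "rise N h (Suc p) q < rise N h (Suc p) i" using i(2) by simp
  then consider "i < q" | "q < i" by force
  then show False
  proof cases
    case 1
    then have "g' i < 1" using Q.g_less[OF i(1) q(1) _ q_below_i] q(3) by simp
    then show False using Q.g_range[OF i(1)] by simp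
  next
    case 2
    then show False using Q.f_less[OF q(1) i(1) _ q_below_i] q(2) by simp
  qed
qed

lemma step_le: "step p \<le> int n"
proof -
  let ?B = "{i \<in> frame p. rise N h p i \<le> step p - 1}"
  have "insert (p + N) ?B \<subseteq> {i \<in> frame (Suc p). f' i = m}"
  proof
    fix i assume "i \<in> insert (p + N) ?B"
    then consider "i = p + N" | "i \<in> ?B" by blast
    then show "i \<in> {i \<in> frame (Suc p). f' i = m}"
    proof cases
      case 2
      then have "i \<in> frame (Suc p)" by (intro mem_next_frame) auto
      moreover have "int N - step p < rise N h (Suc p) i"
        using 2 rise_eq_diff[of "Suc p" i p] rise_pos[of i p] by simp
      ultimately show ?thesis using above_base_imp_last_column by simp
    qed (use base_mem base_in_last_column in simp)
  qed
  then have "card (insert (p + N) ?B) \<le> card {i \<in> frame (Suc p). f' i = m}"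
    by (rule card_mono[rotated]) simp
  also have "\<dots> = n" using Q.card_column[of m] labels_pos by simp
  finally have "card (insert (p + N) ?B) \<le> n" .
  then have "card ?B + 1 \<le> n" by simp
  then show ?thesis
    using card_rise_le[of "step p - 1" p] rise_pos[OF next_mem] rise_less[of p "Suc p"] by simp
qed

end

context extremal_arrangement
begin

lemma step_eq_n:
  assumes "step p < rise N h p (p + m * n)"
  shows "step p = int n"
proof -
  obtain f g f' g' where "erdos_szekeres_labelling (frame p) (rise N h p) m n f g"
    "erdos_szekeres_labelling (frame (Suc p)) (rise N h (Suc p)) m n f' g'"
    using labelling_exists by blast
  then interpret consecutive_labellings N h m n p f g f' g'
    using assms extremal_arrangement_axioms
    by (simp add: consecutive_labellings_def consecutive_labellings_axioms_def)
  show ?thesis using step_le step_ge labels_pos by (intro antisym) auto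
qed

lemma step_eq_minus_m:
  assumes "2 \<le> m * n" "rise N h p (p + m * n) < step p"
  shows "step p = int N - int m"
proof -
  interpret U: extremal_arrangement N "\<lambda>i. - h i" n m by (rule extremal_arrangement_uminus)
  have "U.step p = int N - step p" "rise N (\<lambda>i. - h i) p (p + m * n) = int N - rise N h p (p + m * n)"
    using next_and_last_mem[OF assms(1)] by (auto intro: rise_uminus)
  then show ?thesis using U.step_eq_n[of p] assms(2) by (simp add: mult.commute)
qed

lemma step_Suc_cases:
  assumes "2 \<le> m * n"
  obtains "step (Suc p) < int N - step p" "step (Suc p) = int n"
  | "int N - step p < step (Suc p)" "step (Suc p) = int N - int m"
proof -
  have base: "rise N h (Suc p) (Suc p + m * n) = int N - step p"
    using rise_reverse[OF next_and_last_mem(1)[OF assms], of p] unfolding N_eq by simp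
  have "Suc (Suc p) \<noteq> Suc p + m * n" using assms by linarith
  then have "step (Suc p) \<noteq> rise N h (Suc p) (Suc p + m * n)"
    using inj_on_eq_iff[OF inj_on_rise next_and_last_mem[OF assms, of "Suc p"]] by simp
  then show thesis
    using that step_eq_n[of "Suc p"] step_eq_minus_m[OF assms, of "Suc p"] base by linarith
qed

lemma step_cases:
  assumes "2 \<le> m * n"
  shows "step p = int n \<or> step p = int N - int m"
proof -
  have "Suc (p + m * n) = p + 1 * N" using N_eq by simp
  then have "step (Suc (p + m * n)) = step p" using rise_cong_period[of p 1 "Suc p"] by (simp only: add_Suc)
  then show ?thesis using step_Suc_cases[OF assms, of "p + m * n"] by metis
qed

lemma step_constant_if_persistent:
  assumes persistent: "\<And>p. step p = d \<Longrightarrow> step (Suc p) = d"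
  shows "(\<forall>p. step p = d) \<or> (\<forall>p. step p \<noteq> d)"
proof -
  have "step q = d" if "step p = d" for p q
  proof -
    have later: "step (p + t) = d" for t
      by (induction t) (use that persistent in auto)
    have "p \<le> q + p * N" using N_pos by (cases N) auto
    then obtain t where "q + p * N = p + t" by (rule le_Suc_ex[THEN exE])
    then have "step (q + p * N) = d" using later by simp
    then show ?thesis using rise_cong_period[of q p "Suc q"] by simp
  qed
  then show ?thesis by blast
qed

lemma step_constant:
  assumes "2 \<le> m * n"
  shows "(\<forall>p. step p = int n) \<or> (\<forall>p. step p = int N - int m)"
proof (cases "m \<le> n")
  case True
  have "step (Suc p) = int N - int m" if "step p = int N - int m" for p
    using that True by (cases rule: step_Suc_cases[OF assms, of p]) auto
  then show ?thesis using step_constant_if_persistent step_cases[OF assms] by metis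
next
  case False
  have "step (Suc p) = int n" if "step p = int n" for p
    using that False by (cases rule: step_Suc_cases[OF assms, of p]) auto
  then show ?thesis using step_constant_if_persistent step_cases[OF assms] by metis
qed

lemma rise_linear:
  obtains d where "d = int n \<or> d = - int m" "\<And>i. rise N h 0 i = d * int i mod int N"
proof -
  have N_minus: "(int N - int m) mod int N = - int m mod int N" by (simp add: mod_eq_dvd_iff)
  consider "m * n = 0" | "m * n = 1" | "2 \<le> m * n" by linarith
  then have "(\<forall>p. step p = int n mod int N) \<or> (\<forall>p. step p = - int m mod int N)"
  proof cases
    case 1
    then have "N = 1" using N_eq by simp
    then show ?thesis by (simp add: rise_def)
  next
    case 2
    then have "step p = 1" for p using rise_pos[of "Suc p" p] rise_less[of p "Suc p"] N_eq by simp
    then show ?thesis using 2 N_eq by simp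
  next
    case 3
    have "step p mod int N = step p" for p using rise_nonneg rise_less by (intro mod_pos_pos_trivial)
    then show ?thesis using step_constant[OF 3] N_minus by metis
  qed
  then show thesis using rise_eq_mult that by blast
qed

end

subsection \<open>Cyclic sub-permutations\<close>

lemma Cyc_eq_iff: "Cyc xs = Cyc ys \<longleftrightarrow> (\<exists>q. ys = rotate q xs)"
  by (simp add: cyc.abs_eq_iff rotation_of_def)

lemma Cyc_rotate: "Cyc (rotate q xs) = Cyc xs"
  using Cyc_eq_iff by metis

lemma Cyc_append_commute: "Cyc (xs @ ys) = Cyc (ys @ xs)"
  by (metis Cyc_rotate rotate_append)

lemma Cyc_eqE:
  assumes "Cyc xs = Cyc ys"
  obtains us vs where "xs = us @ vs" "ys = vs @ us"
proof -
  obtain q where "ys = rotate q xs" using assms Cyc_eq_iff by blast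
  then show thesis
    using that[of "take (q mod length xs) xs" "drop (q mod length xs) xs"] by (simp add: rotate_drop_take)
qed

lemma Cyc_Cons_eqE:
  assumes "Cyc (b # xs) = Cyc ys"
  obtains us vs where "xs = us @ vs" "ys = vs @ b # us"
proof -
  obtain us vs where "b # xs = us @ vs" "ys = vs @ us" using Cyc_eqE[OF assms] .
  then show thesis using that[of xs "[]"] that[of "tl us" vs] by (cases us) auto
qed

lemma Cyc_rev_eq_iff: "Cyc (rev xs) = Cyc (rev ys) \<longleftrightarrow> Cyc xs = Cyc ys"
  by (metis Cyc_eq_iff rev_rev_ident rotate_rev)

lemma Cyc_in_cyclic_perms: "Cyc xs \<in> cyclic_perms A \<longleftrightarrow> distinct xs \<and> set xs = A"
  by (simp add: cyclic_perms_def cyc_distinct.abs_eq cyc_set.abs_eq)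

lemma cyclic_perms_starting_at:
  assumes "\<sigma> \<in> cyclic_perms A" "a \<in> A"
  obtains xs where "\<sigma> = Cyc (a # xs)" "distinct (a # xs)" "set (a # xs) = A"
proof -
  obtain ys where ys: "\<sigma> = Cyc ys" by (induction \<sigma> rule: cyc.abs_induct) blast
  then have "a \<in> set ys" using assms by (simp add: Cyc_in_cyclic_perms)
  then obtain us vs where "ys = us @ a # vs" by (meson split_list)
  then have "\<sigma> = Cyc (a # vs @ us)" using ys Cyc_append_commute[of us "a # vs"] by simp
  then show thesis using that assms(1) Cyc_in_cyclic_perms by metis
qed

lemma Cyc_Cons_eq_iff:
  assumes "distinct (b # xs)"
  shows "Cyc (b # xs) = Cyc (b # ys) \<longleftrightarrow> xs = ys"
proof
  assume "Cyc (b # xs) = Cyc (b # ys)"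
  then obtain us vs where "xs = us @ vs" "b # ys = vs @ b # us" by (rule Cyc_Cons_eqE)
  then show "xs = ys" using assms by (cases vs) auto
qed simp

lemma cyc_decreasing_rev_iff: "cyc_decreasing (Cyc (rev xs)) \<longleftrightarrow> cyc_increasing (Cyc xs)"
  unfolding cyc_decreasing_def cyc_increasing_def
  by (metis Cyc_rev_eq_iff rev_rev_ident sorted_wrt_rev)

lemma cyc_increasing_perms_eq:
  fixes A :: "'a::linorder set"
  assumes "finite A"
  shows "{\<sigma> \<in> cyclic_perms A. cyc_increasing \<sigma>} = {Cyc (sorted_list_of_set A)}"
  using assms by (auto simp: cyc_increasing_def Cyc_in_cyclic_perms strict_sorted_iff
      sorted_list_of_set.idem_if_sorted_distinct)

lemma cyc_decreasing_perms_eq: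
  fixes A :: "'a::linorder set"
  assumes "finite A"
  shows "{\<sigma> \<in> cyclic_perms A. cyc_decreasing \<sigma>} = {Cyc (rev (sorted_list_of_set A))}"
proof -
  have "xs = rev (sorted_list_of_set A)" if "sorted_wrt (>) xs" "set xs = A" for xs
  proof -
    have "sorted_wrt (<) (rev xs)" using that(1) by (simp add: sorted_wrt_rev)
    then have "sorted_list_of_set A = rev xs"
      using that(2) assms by (metis set_rev set_sorted_list_of_set strict_sorted_equal strict_sorted_list_of_set)
    then show ?thesis by simp
  qed
  then show ?thesis
    using assms by (fastforce simp: cyc_decreasing_def Cyc_in_cyclic_perms sorted_wrt_rev)
qed

definition rotated_less :: "'a::linorder \<Rightarrow> 'a \<Rightarrow> 'a \<Rightarrow> bool" where
  "rotated_less b x y \<longleftrightarrow> (if b \<le> x \<longleftrightarrow> b \<le> y then x < y else b \<le> x)"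

lemma sorted_wrt_eq_filter_append:
  assumes "sorted_wrt R ys" and "\<And>x y. \<lbrakk>x \<in> set ys; y \<in> set ys; \<not> P x; P y\<rbrakk> \<Longrightarrow> \<not> R x y"
  shows "ys = filter P ys @ filter (\<lambda>x. \<not> P x) ys"
  using assms
proof (induction ys)
  case (Cons x ys)
  then have IH: "ys = filter P ys @ filter (\<lambda>x. \<not> P x) ys" by auto
  show ?case
  proof (cases "P x")
    case True
    then show ?thesis using IH by simp
  next
    case False
    then have "filter P ys = []" using Cons.prems by (auto simp: filter_empty_conv)
    then show ?thesis using IH False by simp
  qed
qed simp

lemma cyc_increasing_Cons_iff:
  assumes "b \<notin> set ys"
  shows "cyc_increasing (Cyc (b # ys)) \<longleftrightarrow> sorted_wrt (rotated_less b) ys"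
proof
  assume "cyc_increasing (Cyc (b # ys))"
  then obtain zs where "Cyc (b # ys) = Cyc zs" "sorted_wrt (<) zs" by (auto simp: cyc_increasing_def)
  then obtain us vs where ys: "ys = us @ vs" and sorted: "sorted_wrt (<) (vs @ b # us)"
    using Cyc_Cons_eqE by metis
  then have "sorted_wrt (rotated_less b) us" "sorted_wrt (rotated_less b) vs"
    by (auto simp: sorted_wrt_append rotated_less_def less_imp_le not_le
        intro!: sorted_wrt_mono_rel[of _ "(<)" "rotated_less b"] dest: bspec order.strict_trans2)
  then show "sorted_wrt (rotated_less b) ys"
    using ys sorted by (auto simp: sorted_wrt_append rotated_less_def)
next
  assume sorted: "sorted_wrt (rotated_less b) ys"
  let ?us = "filter (\<lambda>x. b \<le> x) ys" and ?vs = "filter (\<lambda>x. \<not> b \<le> x) ys"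
  have ys: "ys = ?us @ ?vs"
    by (rule sorted_wrt_eq_filter_append[OF sorted]) (simp add: rotated_less_def)
  have "sorted_wrt (<) ?us" "sorted_wrt (<) ?vs"
    by (auto intro!: sorted_wrt_mono_rel[OF _ sorted_wrt_filter[OF sorted]] simp: rotated_less_def)
  then have "sorted_wrt (<) (?vs @ b # ?us)"
    using assms by (auto simp: sorted_wrt_append le_less)
  moreover have "Cyc (b # ys) = Cyc (?vs @ b # ?us)"
    using ys Cyc_append_commute[of "b # ?us" ?vs] by simp
  ultimately show "cyc_increasing (Cyc (b # ys))" unfolding cyc_increasing_def by blast
qed

lemma cyc_decreasing_Cons_iff:
  assumes "b \<notin> set ys"
  shows "cyc_decreasing (Cyc (b # ys)) \<longleftrightarrow> sorted_wrt (\<lambda>x y. rotated_less b y x) ys"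
proof -
  have "cyc_decreasing (Cyc (b # ys)) \<longleftrightarrow> cyc_increasing (Cyc (rev (b # ys)))"
    using cyc_decreasing_rev_iff[of "rev (b # ys)"] by simp
  also have "Cyc (rev (b # ys)) = Cyc (b # rev ys)" using Cyc_append_commute[of "rev ys" "[b]"] by simp
  also have "cyc_increasing \<dots> \<longleftrightarrow> sorted_wrt (\<lambda>x y. rotated_less b y x) ys"
    using assms by (simp add: cyc_increasing_Cons_iff sorted_wrt_rev)
  finally show ?thesis .
qed

definition cyc_nth :: "'a list \<Rightarrow> nat \<Rightarrow> 'a" where
  "cyc_nth xs i = xs ! (i mod length xs)"

lemma rotate_eq_map_cyc_nth: "rotate p xs = map (cyc_nth xs) [p..<p + length xs]"
  by (rule nth_equalityI) (simp_all add: nth_rotate cyc_nth_def)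

lemma cyclic_sub_subseq_rotate:
  assumes "cyclic_sub (Cyc zs) (Cyc xs)"
  shows "\<exists>q. subseq zs (rotate q xs)"
proof -
  obtain ys xs' where eq: "Cyc zs = Cyc ys" "Cyc xs = Cyc xs'" and sub: "subseq ys xs'"
    using assms unfolding cyclic_sub_def by blast
  obtain us vs where zs: "ys = us @ vs" "zs = vs @ us" using Cyc_eqE[OF eq(1)[symmetric]] .
  then obtain us' vs' where xs': "xs' = us' @ vs'" "subseq us us'" "subseq vs vs'"
    using list_emb_appendD sub by metis
  then have "subseq zs (vs' @ us')" using zs by (simp add: list_emb_append_mono)
  moreover have "Cyc xs = Cyc (vs' @ us')" using eq(2) xs'(1) Cyc_append_commute by metis
  ultimately show ?thesis using Cyc_eq_iff by metis
qed

lemma cyclic_sub_Cyc_Suc_iff: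
  "cyclic_sub \<tau> (Cyc xs) \<and> cyc_length \<tau> = Suc t \<longleftrightarrow>
    (\<exists>p S. S \<subseteq> {p<..<p + length xs} \<and> card S = t \<and> xs \<noteq> [] \<and>
      \<tau> = Cyc (map (cyc_nth xs) (p # sorted_list_of_set S)))"
proof (intro iffI; elim conjE exE)
  assume sub: "cyclic_sub \<tau> (Cyc xs)" and len: "cyc_length \<tau> = Suc t"
  obtain zs where \<tau>: "\<tau> = Cyc zs" by (induction \<tau> rule: cyc.abs_induct) blast
  then obtain q where "subseq zs (rotate q xs)" using sub cyclic_sub_subseq_rotate by blast
  then obtain ps where zs: "zs = map (cyc_nth xs) ps" and sub: "subseq ps [q..<q + length xs]"
    unfolding rotate_eq_map_cyc_nth by (auto simp: subseq_conv_nths nths_map)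
  then have sorted: "sorted_wrt (<) ps" and range: "set ps \<subseteq> {q..<q + length xs}"
    by (auto simp: subseq_conv_nths strict_sorted_iff sorted_nths dest: in_set_nthsD)
  obtain p js where ps: "ps = p # js" using zs \<tau> len by (cases ps) (auto simp: cyc_length.abs_eq)
  have "set js \<subseteq> {p<..<p + length xs}" "card (set js) = t" "xs \<noteq> []"
    using sorted range len \<tau> zs ps by (auto simp: strict_sorted_iff cyc_length.abs_eq distinct_card)
  moreover have "sorted_list_of_set (set js) = js"
    using sorted ps by (simp add: strict_sorted_iff sorted_list_of_set.idem_if_sorted_distinct)
  ultimately show "\<exists>p S. S \<subseteq> {p<..<p + length xs} \<and> card S = t \<and> xs \<noteq> [] \<and>
      \<tau> = Cyc (map (cyc_nth xs) (p # sorted_list_of_set S))"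
    using \<tau> zs ps by metis
next
  fix p S
  assume S: "S \<subseteq> {p<..<p + length xs}" "card S = t" and "xs \<noteq> []"
    and \<tau>: "\<tau> = Cyc (map (cyc_nth xs) (p # sorted_list_of_set S))"
  have "finite S" using S(1) finite_subset by blast
  then have "subseq (p # sorted_list_of_set S) [p..<p + length xs]"
    using S(1) \<open>xs \<noteq> []\<close> by (intro sorted_subset_imp_subseq) auto
  then have "subseq (map (cyc_nth xs) (p # sorted_list_of_set S)) (rotate p xs)"
    unfolding rotate_eq_map_cyc_nth by (rule subseq_map)
  then have "cyclic_sub \<tau> (Cyc xs)" unfolding cyclic_sub_def \<tau> using Cyc_rotate by metis
  then show "cyclic_sub \<tau> (Cyc xs) \<and> cyc_length \<tau> = Suc t"
    using \<tau> S(2) by (simp add: cyc_length.abs_eq)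
qed

lemma sorted_wrt_sorted_list_of_set_iff:
  fixes S :: "'a::linorder set"
  assumes "finite S"
  shows "sorted_wrt R (sorted_list_of_set S) \<longleftrightarrow> (\<forall>x\<in>S. \<forall>y\<in>S. x < y \<longrightarrow> R x y)"
proof -
  have "sorted_wrt R xs \<longleftrightarrow> (\<forall>x\<in>set xs. \<forall>y\<in>set xs. x < y \<longrightarrow> R x y)" if "sorted_wrt (<) xs" for xs :: "'a list"
    using that by (induction xs) (auto dest: order.asym)
  then show ?thesis using assms by (metis set_sorted_list_of_set strict_sorted_list_of_set)
qed

definition heights :: "nat list \<Rightarrow> nat \<Rightarrow> int" where
  "heights xs i = int (cyc_nth xs i)"

lemma cyc_nth_mem: "xs \<noteq> [] \<Longrightarrow> cyc_nth xs i \<in> set xs"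
  by (simp add: cyc_nth_def)

lemma cyc_nth_neq:
  assumes "distinct xs" "i < j" "j < i + length xs"
  shows "cyc_nth xs i \<noteq> cyc_nth xs j"
proof
  assume eq: "cyc_nth xs i = cyc_nth xs j"
  have "xs \<noteq> []" using assms(2,3) by auto
  then have "i mod length xs = j mod length xs"
    using eq assms(1) by (simp add: cyc_nth_def nth_eq_iff_index_eq)
  then have "length xs dvd j - i" using assms(2) mod_eq_dvd_iff_nat[of i j "length xs"] by simp
  then show False using assms by (auto dest!: dvd_imp_le)
qed

lemma rotated_less_iff_mod_less:
  fixes b x y N :: nat
  assumes "b \<in> {1..N}" "x \<in> {1..N}" "y \<in> {1..N}"
  shows "rotated_less b x y \<longleftrightarrow> (int x - int b) mod int N < (int y - int b) mod int N"
proof -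
  have "(int z - int b) mod int N = (if b \<le> z then int z - int b else int z - int b + int N)"
    if "z \<in> {1..N}" for z
    using that assms(1) mod_eq_if_abs_less[of "int z - int b" "int N"] by auto
  then show ?thesis using assms by (auto simp: rotated_less_def)
qed

lemma length_if_cyclic_perm:
  assumes "Cyc xs \<in> cyclic_perms {1..N}"
  shows "length xs = N"
  using assms by (metis Cyc_in_cyclic_perms card_atLeastAtMost diff_Suc_1 distinct_card)

lemma cyc_nth_mem_if_cyclic_perm:
  fixes N :: nat
  assumes "Cyc xs \<in> cyclic_perms {1..N}" "0 < N"
  shows "cyc_nth xs i \<in> {1..N}"
  using assms length_if_cyclic_perm[OF assms(1)] cyc_nth_mem[of xs i] by (force simp: Cyc_in_cyclic_perms)

lemma cyclic_arrangement_heights: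
  assumes perm: "Cyc xs \<in> cyclic_perms {1..N}" and "0 < N"
  shows "cyclic_arrangement N (heights xs)"
proof (rule cyclic_arrangement.intro)
  note len = length_if_cyclic_perm[OF perm]
  show "heights xs (i + N) = heights xs i" for i by (simp add: heights_def cyc_nth_def len)
  show "heights xs i mod int N \<noteq> heights xs j mod int N" if ij: "i < j" "j < i + N" for i j
  proof -
    have "\<bar>heights xs i - heights xs j\<bar> < int N"
      using cyc_nth_mem_if_cyclic_perm[OF assms, of i] cyc_nth_mem_if_cyclic_perm[OF assms, of j] by (auto simp: heights_def)
    moreover have "heights xs i \<noteq> heights xs j"
      using cyc_nth_neq[of xs i j] perm ij len by (simp add: heights_def Cyc_in_cyclic_perms)
    ultimately show ?thesis
      using dvd_imp_le_int[of "heights xs i - heights xs j" "int N"] by (auto simp: mod_eq_dvd_iff)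
  qed
qed (rule assms(2))

lemma cyc_monotone_map_cyc_nth_iff:
  assumes perm: "Cyc xs \<in> cyclic_perms {1..N}" and "0 < N" and S: "S \<subseteq> {p<..<p + N}"
  defines "ys \<equiv> map (cyc_nth xs) (p # sorted_list_of_set S)"
  shows "cyc_increasing (Cyc ys) \<longleftrightarrow> strict_mono_on S (rise N (heights xs) p)"
    and "cyc_decreasing (Cyc ys) \<longleftrightarrow> strict_antimono_on S (rise N (heights xs) p)"
proof -
  have "finite S" using S finite_subset by blast
  have "cyc_nth xs p \<noteq> cyc_nth xs i" if "i \<in> S" for i
    using perm that S length_if_cyclic_perm[OF perm] by (intro cyc_nth_neq) (auto simp: Cyc_in_cyclic_perms)
  then have "cyc_nth xs p \<notin> cyc_nth xs ` S" by blast
  moreover have "rotated_less (cyc_nth xs p) (cyc_nth xs i) (cyc_nth xs j) \<longleftrightarrow>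
      rise N (heights xs) p i < rise N (heights xs) p j" for i j
    using rotated_less_iff_mod_less cyc_nth_mem_if_cyclic_perm[OF perm \<open>0 < N\<close>] by (simp add: rise_def heights_def)
  ultimately show "cyc_increasing (Cyc ys) \<longleftrightarrow> strict_mono_on S (rise N (heights xs) p)"
    "cyc_decreasing (Cyc ys) \<longleftrightarrow> strict_antimono_on S (rise N (heights xs) p)"
    using \<open>finite S\<close> unfolding ys_def list.map
    by (simp_all add: cyc_increasing_Cons_iff cyc_decreasing_Cons_iff sorted_wrt_map
        sorted_wrt_sorted_list_of_set_iff monotone_on_def)
qed

lemma all_card_le_iff_no_Suc:
  assumes "\<And>S T. \<lbrakk>P S; T \<subseteq> S\<rbrakk> \<Longrightarrow> P T"
  shows "(\<forall>S. P S \<longrightarrow> card S \<le> K) \<longleftrightarrow> \<not> (\<exists>S. P S \<and> card S = Suc K)"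
  using assms by (metis Suc_n_not_le_n not_less_eq_eq obtain_subset_with_card_n)

lemma no_cyclic_sub_iff_card_le:
  assumes "xs \<noteq> []"
    and Q_iff: "\<And>p S. S \<subseteq> {p<..<p + length xs} \<Longrightarrow>
      Q (Cyc (map (cyc_nth xs) (p # sorted_list_of_set S))) \<longleftrightarrow> R p S"
    and R_subset: "\<And>p S T. \<lbrakk>R p S; T \<subseteq> S\<rbrakk> \<Longrightarrow> R p T"
  shows "\<not> (\<exists>\<tau>. cyclic_sub \<tau> (Cyc xs) \<and> Q \<tau> \<and> cyc_length \<tau> = Suc (Suc K)) \<longleftrightarrow>
    (\<forall>p S. S \<subseteq> {p<..<p + length xs} \<and> R p S \<longrightarrow> card S \<le> K)"
proof -
  have "(\<exists>\<tau>. cyclic_sub \<tau> (Cyc xs) \<and> Q \<tau> \<and> cyc_length \<tau> = Suc (Suc K)) \<longleftrightarrow>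
      (\<exists>p S. (S \<subseteq> {p<..<p + length xs} \<and> R p S) \<and> card S = Suc K)"
    using cyclic_sub_Cyc_Suc_iff[of _ xs "Suc K"] Q_iff assms(1) by metis
  moreover have "(\<forall>S. S \<subseteq> {p<..<p + length xs} \<and> R p S \<longrightarrow> card S \<le> K) \<longleftrightarrow>
      \<not> (\<exists>S. (S \<subseteq> {p<..<p + length xs} \<and> R p S) \<and> card S = Suc K)" for p
    using R_subset by (intro all_card_le_iff_no_Suc) blast
  ultimately show ?thesis by simp
qed

lemma Cyc_in_CC_iff:
  assumes "N = m * n + 1"
  shows "Cyc xs \<in> CC (m + 1) (n + 1) \<longleftrightarrow>
    Cyc xs \<in> cyclic_perms {1..N} \<and> extremal_arrangement N (heights xs) m n"
proof (cases "Cyc xs \<in> cyclic_perms {1..N}")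
  case True
  have "0 < N" using assms by simp
  note len = length_if_cyclic_perm[OF True]
  have "xs \<noteq> []" using len \<open>0 < N\<close> by auto
  note no_sub_iff = no_cyclic_sub_iff_card_le[OF this, unfolded len]
    and monotone_iff = cyc_monotone_map_cyc_nth_iff[OF True \<open>0 < N\<close>]
  have increasing:
    "\<not> (\<exists>\<tau>. cyclic_sub \<tau> (Cyc xs) \<and> cyc_increasing \<tau> \<and> cyc_length \<tau> = Suc (Suc m)) \<longleftrightarrow>
      (\<forall>p S. S \<subseteq> {p<..<p + N} \<and> strict_mono_on S (rise N (heights xs) p) \<longrightarrow> card S \<le> m)"
    by (rule no_sub_iff) (simp only: monotone_iff(1), erule (1) monotone_on_subset)
  have decreasing:
    "\<not> (\<exists>\<tau>. cyclic_sub \<tau> (Cyc xs) \<and> cyc_decreasing \<tau> \<and> cyc_length \<tau> = Suc (Suc n)) \<longleftrightarrow>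
      (\<forall>p S. S \<subseteq> {p<..<p + N} \<and> strict_antimono_on S (rise N (heights xs) p) \<longrightarrow> card S \<le> n)"
    by (rule no_sub_iff) (simp only: monotone_iff(2), erule (1) monotone_on_subset)
  have "Cyc xs \<in> CC (m + 1) (n + 1) \<longleftrightarrow>
    \<not> (\<exists>\<tau>. cyclic_sub \<tau> (Cyc xs) \<and> cyc_increasing \<tau> \<and> cyc_length \<tau> = Suc (Suc m)) \<and>
    \<not> (\<exists>\<tau>. cyclic_sub \<tau> (Cyc xs) \<and> cyc_decreasing \<tau> \<and> cyc_length \<tau> = Suc (Suc n))"
    using True assms by (simp add: CC_def)
  then show ?thesis
    unfolding increasing decreasing extremal_arrangement_def extremal_arrangement_axioms_def
    using True assms cyclic_arrangement_heights[OF True \<open>0 < N\<close>] by auto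
qed (simp add: CC_def assms)

subsection \<open>The two lattice arrangements\<close>

definition lattice_list :: "nat \<Rightarrow> int \<Rightarrow> nat list" where
  "lattice_list N d = map (\<lambda>i. nat (d * int i mod int N) + 1) [0..<N]"

lemma length_lattice_list [simp]: "length (lattice_list N d) = N"
  by (simp add: lattice_list_def)

lemma lattice_list_Cons:
  assumes "0 < N"
  shows "lattice_list N d = 1 # map (\<lambda>i. nat (d * int i mod int N) + 1) [1..<N]"
  using assms by (simp add: lattice_list_def upt_conv_Cons)

lemma lattice_list_cong: "int N dvd d - e \<Longrightarrow> lattice_list N d = lattice_list N e"
  unfolding lattice_list_def by (metis mod_eq_dvd_iff mod_mult_left_eq)

lemma heights_lattice_list:
  assumes "0 < N"
  shows "heights (lattice_list N d) i = d * int i mod int N + 1"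
proof -
  have "d * int (i mod N) mod int N = d * int i mod int N"
    by (simp only: zmod_int mod_mult_right_eq)
  then show ?thesis using assms by (simp add: heights_def cyc_nth_def lattice_list_def)
qed

lemma rise_heights_lattice_list:
  assumes "0 < N"
  shows "rise N (heights (lattice_list N d)) p i = d * (int i - int p) mod int N"
  by (simp add: rise_def heights_lattice_list[OF assms] mod_diff_eq right_diff_distrib)

lemma Cyc_lattice_list_in_cyclic_perms:
  assumes "0 < N" "coprime d (int N)"
  shows "Cyc (lattice_list N d) \<in> cyclic_perms {1..N}"
proof -
  have "inj_on (\<lambda>i. nat (d * int i mod int N) + 1) {0..<N}"
  proof (rule linorder_inj_onI')
    fix i j assume ij: "i \<in> {0..<N}" "j \<in> {0..<N}" "i < j"
    then have "\<not> int N dvd int j - int i" by (auto dest: zdvd_imp_le)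
    then have "d * int j mod int N \<noteq> d * int i mod int N"
      using assms(2) by (simp add: mod_eq_dvd_iff coprime_dvd_mult_right_iff coprime_commute flip: right_diff_distrib)
    then show "nat (d * int i mod int N) + 1 \<noteq> nat (d * int j mod int N) + 1"
      using assms(1) by (simp add: nat_eq_iff)
  qed
  then have "distinct (lattice_list N d)" by (simp add: lattice_list_def distinct_map)
  moreover have "set (lattice_list N d) = {1..N}"
  proof (rule card_subset_eq)
    have "nat (x mod int N) < N" for x using assms(1) by (simp add: nat_less_iff)
    then show "set (lattice_list N d) \<subseteq> {1..N}" by (auto simp: lattice_list_def Suc_le_eq)
    show "card (set (lattice_list N d)) = card {1..N}" using distinct_card[OF calculation] by simp
  qed simp
  ultimately show ?thesis by (simp add: Cyc_in_cyclic_perms)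
qed

lemma (in cyclic_arrangement) card_increasing_less_if_linear:
  fixes \<alpha> \<beta> :: nat and d :: int
  assumes linear: "\<And>i. rise N h p i = d * (int i - int p) mod int N"
    and S: "S \<subseteq> frame p" "strict_mono_on S (rise N h p)"
    and dvd: "int N dvd int \<alpha> + int \<beta> * d" and pos: "0 < \<alpha> + \<beta>"
  shows "card S < \<alpha> + \<beta>"
proof -
  \<comment> \<open>On \<open>S\<close> the form \<open>\<phi>\<close> takes distinct values, all of them
    multiples of \<open>N\<close> strictly between \<open>0\<close> and \<open>(\<alpha> + \<beta>) N\<close>.\<close>
  define \<phi> where "\<phi> i = int \<alpha> * (int i - int p) + int \<beta> * rise N h p i" for i
  have dvd_\<phi>: "int N dvd \<phi> i" for i
  proof -
    have "int N dvd rise N h p i - d * (int i - int p)" by (simp add: linear flip: mod_eq_dvd_iff)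
    from dvd_add[OF dvd_mult2[OF dvd, of "int i - int p"] dvd_mult[OF this, of "int \<beta>"]]
    show ?thesis by (simp add: \<phi>_def algebra_simps)
  qed
  have less: "int \<alpha> * x + int \<beta> * y < int \<alpha> * x' + int \<beta> * y'" if "x < x'" "y < y'" for x y x' y' :: int
    using pos that by (cases "\<alpha> = 0") (simp_all add: add_less_le_mono mult_left_mono)
  have \<phi>_range: "0 < \<phi> i" "\<phi> i < int (\<alpha> + \<beta>) * int N" if "i \<in> S" for i
    using that S(1) less[of 0 "int i - int p" 0 "rise N h p i"]
      less[of "int i - int p" "int N" "rise N h p i" "int N"] rise_pos[of i p] rise_less[of p i]
    by (auto simp: \<phi>_def algebra_simps)
  have "\<phi> i < \<phi> j" if "i \<in> S" "j \<in> S" "i < j" for i j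
    unfolding \<phi>_def using that strict_mono_onD[OF S(2)] by (intro less) auto
  then have "inj_on \<phi> S" by (intro linorder_inj_onI') fastforce
  then have "inj_on (\<lambda>i. \<phi> i div int N) S"
    using dvd_\<phi> N_pos by (auto simp: inj_on_def dvd_div_eq_iff)
  moreover have "\<phi> i div int N \<in> {0<..<int (\<alpha> + \<beta>)}" if "i \<in> S" for i
    using \<phi>_range[OF that] dvd_\<phi>[of i] N_pos by (auto elim!: dvdE simp: zero_less_mult_iff)
  ultimately have "card S \<le> card {0<..<int (\<alpha> + \<beta>)}"
    by (intro card_inj_on_le[of "\<lambda>i. \<phi> i div int N"]) auto
  then show ?thesis using pos by (simp, linarith)
qed

lemma (in cyclic_arrangement) card_increasing_le_if_lattice:
  assumes linear: "\<And>i. rise N h p i = d * (int i - int p) mod int N"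
    and S: "S \<subseteq> frame p" "strict_mono_on S (rise N h p)"
    and N: "N = m * n + 1" and d: "d = int n \<or> d = - int m"
  shows "card S \<le> m"
  using d
proof
  assume "d = int n"
  then show ?thesis using card_increasing_less_if_linear[OF linear S, of 1 m] N by simp
next
  assume "d = - int m"
  then show ?thesis using card_increasing_less_if_linear[OF linear S, of m 1] by simp
qed

lemma extremal_arrangement_lattice_list:
  assumes N: "N = m * n + 1" and d: "d = int n \<or> d = - int m"
    and perm: "Cyc (lattice_list N d) \<in> cyclic_perms {1..N}"
  shows "extremal_arrangement N (heights (lattice_list N d)) m n"
proof -
  let ?h = "heights (lattice_list N d)"
  have "0 < N" using N by simp
  interpret L: cyclic_arrangement N ?h using cyclic_arrangement_heights[OF perm \<open>0 < N\<close>] .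
  interpret U: cyclic_arrangement N "\<lambda>i. - ?h i" by (rule L.cyclic_arrangement_uminus)
  note linear = rise_heights_lattice_list[OF \<open>0 < N\<close>, of d]
  have linear_uminus: "rise N (\<lambda>i. - ?h i) p i = - d * (int i - int p) mod int N" for p i
  proof -
    have "rise N (\<lambda>i. - ?h i) p i = - rise N ?h p i mod int N" by (simp add: rise_def mod_minus_eq)
    then show ?thesis by (simp add: linear mod_minus_eq)
  qed
  show ?thesis
  proof
    fix S p assume S: "S \<subseteq> {p<..<p + N}"
    show "card S \<le> m" if "strict_mono_on S (rise N ?h p)"
      using L.card_increasing_le_if_lattice[OF linear S that N d] .
    show "card S \<le> n" if "strict_antimono_on S (rise N ?h p)"
    proof (rule U.card_increasing_le_if_lattice[OF linear_uminus S])
      show "strict_mono_on S (rise N (\<lambda>i. - ?h i) p)"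
        using that S L.rise_uminus by (auto simp: monotone_on_def subset_iff)
      show "N = n * m + 1" using N by (simp add: mult.commute)
      show "- d = int m \<or> - d = - int n" using d by auto
    qed
  qed (rule N)
qed

lemma Cyc_lattice_list_in_CC:
  assumes N: "N = m * n + 1" and d: "d = int n \<or> d = - int m"
  shows "Cyc (lattice_list N d) \<in> CC (m + 1) (n + 1)"
proof -
  obtain e where "int N = e * d + 1"
    using d that[of "int m"] that[of "- int n"] N by auto
  then have "coprime d (int N)" by (simp only: coprime_iff_gcd_eq_1 gcd_add_mult) simp
  then have "Cyc (lattice_list N d) \<in> cyclic_perms {1..N}" using N by (intro Cyc_lattice_list_in_cyclic_perms) simp
  then show ?thesis using Cyc_in_CC_iff[OF N] extremal_arrangement_lattice_list[OF N d] by blast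
qed

lemma CC_latticeE:
  assumes N: "N = m * n + 1" and "\<sigma> \<in> CC (m + 1) (n + 1)"
  obtains d where "d = int n \<or> d = - int m" "\<sigma> = Cyc (lattice_list N d)"
proof -
  have "\<sigma> \<in> cyclic_perms {1..N}" "1 \<in> {1..N}" using assms by (simp_all add: CC_def)
  then obtain zs where \<sigma>: "\<sigma> = Cyc (1 # zs)" by (rule cyclic_perms_starting_at)
  let ?xs = "1 # zs"
  have perm: "Cyc ?xs \<in> cyclic_perms {1..N}" and "extremal_arrangement N (heights ?xs) m n"
    using assms(2) Cyc_in_CC_iff[OF N] \<sigma> by auto
  then interpret extremal_arrangement N "heights ?xs" m n by blast
  obtain d where d: "d = int n \<or> d = - int m" "\<And>i. rise N (heights ?xs) 0 i = d * int i mod int N"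
    by (rule rise_linear) blast
  have "?xs = lattice_list N d"
  proof (rule nth_equalityI)
    fix i assume "i < length ?xs"
    then have i: "i < N" "cyc_nth ?xs i = ?xs ! i" using length_if_cyclic_perm[OF perm] by (simp_all add: cyc_nth_def)
    have "d * int i mod int N = (int (?xs ! i) - 1) mod int N"
      using d(2)[of i] i by (simp add: rise_def heights_def cyc_nth_def)
    also have "\<dots> = int (?xs ! i) - 1"
      using cyc_nth_mem_if_cyclic_perm[OF perm N_pos, of i] i(2) by (intro mod_pos_pos_trivial) auto
    finally show "?xs ! i = lattice_list N d ! i"
      using i(1) cyc_nth_mem_if_cyclic_perm[OF perm N_pos, of i] i(2) by (simp add: lattice_list_def nat_diff_distrib)
  qed (use length_if_cyclic_perm[OF perm] in simp)
  then show thesis using that d(1) \<sigma> by simp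
qed

lemma CC_eq_lattice:
  assumes "N = m * n + 1"
  shows "CC (m + 1) (n + 1) = {Cyc (lattice_list N (int n)), Cyc (lattice_list N (- int m))}"
proof
  show "CC (m + 1) (n + 1) \<subseteq> {Cyc (lattice_list N (int n)), Cyc (lattice_list N (- int m))}"
    using CC_latticeE[OF assms] by blast
qed (use Cyc_lattice_list_in_CC[OF assms] in simp)

subsection \<open>The extremal cyclic permutations\<close>

lemma lattice_list_1:
  assumes "0 < N"
  shows "lattice_list N 1 = sorted_list_of_set {1..N}"
proof -
  have "lattice_list N 1 = map Suc [0..<N]" by (simp add: lattice_list_def)
  also have "\<dots> = sorted_list_of_set {1..<Suc N}" by (simp add: map_Suc_upt del: upt_Suc)
  finally show ?thesis by (simp add: atLeastLessThanSuc_atLeastAtMost)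
qed

lemma Cyc_lattice_list_minus_1:
  assumes "0 < N"
  shows "Cyc (lattice_list N (- 1)) = Cyc (rev (sorted_list_of_set {1..N}))"
proof -
  have "nat (- 1 * int i mod int N) + 1 = N + 1 - i" if "i \<in> {1..<N}" for i
  proof -
    have "- 1 * int i mod int N = int (N - i)"
      using that mod_eq_if_abs_less[of "- int i" "int N"] by (simp add: of_nat_diff)
    then have "nat (- 1 * int i mod int N) = N - i" by (simp only: nat_int)
    then show ?thesis using that by (simp add: Suc_diff_le)
  qed
  then have "map (\<lambda>i. nat (- 1 * int i mod int N) + 1) [1..<N] = map (\<lambda>i. N + 1 - i) [1..<N]"
    by (intro map_cong) auto
  also have "\<dots> = rev [2..<Suc N]"
    by (rule nth_equalityI) (auto simp: rev_nth simp del: upt_Suc)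
  finally have "map (\<lambda>i. nat (- 1 * int i mod int N) + 1) [1..<N] = rev [2..<Suc N]" .
  then have "lattice_list N (- 1) = [1] @ rev [2..<Suc N]"
    using lattice_list_Cons[OF assms] by (simp del: upt_Suc)
  then have "Cyc (lattice_list N (- 1)) = Cyc (rev [2..<Suc N] @ [1])"
    using Cyc_append_commute by metis
  also have "rev [2..<Suc N] @ [1] = rev [1..<Suc N]"
    using assms by (subst (2) upt_conv_Cons) (simp_all add: numeral_2_eq_2 del: upt_Suc)
  also have "\<dots> = rev (sorted_list_of_set {1..N})"
    by (simp add: atLeastLessThanSuc_atLeastAtMost flip: sorted_list_of_set_range del: upt_Suc)
  finally show ?thesis .
qed

lemma CC_eq_decreasing:
  assumes "m \<le> 1"
  shows "CC (m + 1) (n + 1) = {\<sigma> \<in> cyclic_perms {1..m * n + 1}. cyc_decreasing \<sigma>}"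
proof -
  let ?N = "m * n + 1"
  have "m = 0 \<or> m = 1" using assms by auto
  then have "int ?N dvd int n - (- 1)" "int ?N dvd - int m - (- 1)" by (auto simp: add.commute)
  then have "lattice_list ?N (int n) = lattice_list ?N (- 1)"
    "lattice_list ?N (- int m) = lattice_list ?N (- 1)"
    using lattice_list_cong by blast+
  then show ?thesis
    unfolding CC_eq_lattice[OF refl] by (simp add: Cyc_lattice_list_minus_1 cyc_decreasing_perms_eq)
qed

lemma CC_eq_increasing:
  assumes "n \<le> 1"
  shows "CC (m + 1) (n + 1) = {\<sigma> \<in> cyclic_perms {1..m * n + 1}. cyc_increasing \<sigma>}"
proof -
  let ?N = "m * n + 1"
  have "n = 0 \<or> n = 1" using assms by auto
  then have "int ?N dvd int n - 1" "int ?N dvd - (- int m - 1)" by auto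
  then have "lattice_list ?N (int n) = lattice_list ?N 1" "lattice_list ?N (- int m) = lattice_list ?N 1"
    using lattice_list_cong dvd_minus_iff by blast+
  then show ?thesis
    unfolding CC_eq_lattice[OF refl] by (simp add: lattice_list_1 cyc_increasing_perms_eq)
qed

lemma card_CC_eq_2:
  assumes "2 \<le> m" "2 \<le> n"
  shows "card (CC (m + 1) (n + 1)) = 2"
proof -
  define N where "N = m * n + 1"
  obtain x y where "m = x + 2" "n = y + 2" using assms by (metis le_add_diff_inverse2)
  then have "m + n \<le> m * n" by simp
  then have N: "0 < N" "1 < N" "m + n < N" using assms by (simp_all add: N_def)
  have "lattice_list N (int n) ! 1 \<noteq> lattice_list N (- int m) ! 1"
  proof -
    have "int n mod int N = int n" using N by simp
    moreover have "- int m mod int N = int (N - m)"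
      using N assms mod_eq_if_abs_less[of "- int m" "int N"] by (simp add: of_nat_diff)
    ultimately show ?thesis using N by (simp add: lattice_list_def)
  qed
  then have "Cyc (lattice_list N (int n)) \<noteq> Cyc (lattice_list N (- int m))"
    using Cyc_in_CC_iff[OF N_def] Cyc_lattice_list_in_CC[OF N_def] Cyc_Cons_eq_iff lattice_list_Cons[OF N(1)]
    by (metis Cyc_in_cyclic_perms)
  then show ?thesis unfolding CC_eq_lattice[OF N_def] by simp
qed

lemma Cyc_eq_lattice_list_iff:
  assumes "Cyc (1 # map a [1..<N]) \<in> cyclic_perms {1..N}" "0 < N"
  shows "Cyc (1 # map a [1..<N]) = Cyc (lattice_list N d) \<longleftrightarrow>
    (\<forall>p\<in>{1..<N}. a p = nat (d * int p mod int N) + 1)"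
  using assms by (auto simp: lattice_list_Cons Cyc_Cons_eq_iff Cyc_in_cyclic_perms simp del: upt_Suc)

lemma block_index_less:
  fixes m n i j :: nat
  assumes "i < n" "j \<in> {1..m}"
  shows "i * m + j < m * n + 1"
proof -
  have "i * m + j \<le> Suc i * m" using assms(2) by simp
  also have "\<dots> \<le> n * m" using assms(1) by (intro mult_right_mono) auto
  finally show ?thesis by (simp add: mult.commute)
qed

lemma ball_block_index:
  fixes u w :: nat
  shows "(\<forall>p\<in>{1..<u * w + 1}. P p) \<longleftrightarrow> (\<forall>i\<in>{1..w}. \<forall>j\<in>{1..u}. P ((j - 1) * w + i))"
proof (intro iffI ballI)
  fix i j assume P: "\<forall>p\<in>{1..<u * w + 1}. P p" and ij: "i \<in> {1..w}" "j \<in> {1..u}"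
  have "(j - 1) * w + i < w * u + 1" by (rule block_index_less) (use ij in auto)
  then have "(j - 1) * w + i < u * w + 1" by (simp only: mult.commute[of u w])
  then show "P ((j - 1) * w + i)" using P ij by auto
next
  fix p assume P: "\<forall>i\<in>{1..w}. \<forall>j\<in>{1..u}. P ((j - 1) * w + i)" and p: "p \<in> {1..<u * w + 1}"
  have "0 < w" using p by (cases w) auto
  then have "(p - 1) mod w + 1 \<in> {1..w}" "(p - 1) div w + 1 \<in> {1..u}"
    using p by (auto simp: Suc_le_eq div_less_iff_less_mult)
  then have "P (((p - 1) div w + 1 - 1) * w + ((p - 1) mod w + 1))" using P by blast
  moreover have "((p - 1) div w + 1 - 1) * w + ((p - 1) mod w + 1) = p" using p by simp
  ultimately show "P p" by simp
qed

lemma nat_mod_int_eq: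
  assumes "x = q * int N + int r" "r < N"
  shows "nat (x mod int N) = r"
proof -
  have "x mod int N = int r" by (rule int_mod_pos_eq[of _ _ q]) (use assms in auto)
  then show ?thesis by simp
qed

lemma lattice_entry_minus_m:
  fixes m n i j :: nat
  assumes "i \<in> {1..n}" "j \<in> {1..m}"
  shows "nat (- int m * int ((j - 1) * n + i) mod int (m * n + 1)) = (n - i) * m + j"
proof (rule nat_mod_int_eq)
  obtain x y where "n = i + x" "j = Suc y"
    using assms by (metis atLeastAtMost_iff le_Suc_ex One_nat_def Suc_le_D)
  then show "- int m * int ((j - 1) * n + i) = - int j * int (m * n + 1) + int ((n - i) * m + j)"
    by (simp add: algebra_simps)
qed (use assms in \<open>intro block_index_less; auto\<close>)

lemma lattice_entry_n:
  fixes m n i j :: nat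
  assumes "i \<in> {1..n}" "j \<in> {1..m}"
  shows "nat (int n * int ((i - 1) * m + j) mod int (m * n + 1)) = (j - 1) * n + (n + 1 - i)"
proof (rule nat_mod_int_eq)
  obtain x y z where "n = i + x" "j = Suc y" "i = Suc z"
    using assms by (metis atLeastAtMost_iff le_Suc_ex One_nat_def Suc_le_D)
  then show "int n * int ((i - 1) * m + j) = int (i - 1) * int (m * n + 1) + int ((j - 1) * n + (n + 1 - i))"
    by (simp add: algebra_simps)
  have "(j - 1) * n + (n + 1 - i) < n * m + 1" by (rule block_index_less) (use assms in auto)
  then show "(j - 1) * n + (n + 1 - i) < m * n + 1" by (simp only: mult.commute[of n m])
qed

lemma Cyc_Cons_in_CC_iff:
  assumes N: "N = m * n + 1" and perm: "Cyc (1 # map a [1..<N]) \<in> cyclic_perms {1..N}"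
  shows "Cyc (1 # map a [1..<N]) \<in> CC (m + 1) (n + 1) \<longleftrightarrow>
    (\<forall>i\<in>{1..n}. \<forall>j\<in>{1..m}. a ((j - 1) * n + i) = (n - i) * m + j + 1) \<or>
    (\<forall>i\<in>{1..n}. \<forall>j\<in>{1..m}. a ((i - 1) * m + j) = (j - 1) * n + (n + 1 - i) + 1)"
proof -
  have "0 < N" using N by simp
  note eq_lattice_iff = Cyc_eq_lattice_list_iff[OF perm this]
  have "Cyc (1 # map a [1..<N]) = Cyc (lattice_list N (- int m)) \<longleftrightarrow>
      (\<forall>i\<in>{1..n}. \<forall>j\<in>{1..m}. a ((j - 1) * n + i) = (n - i) * m + j + 1)"
    unfolding eq_lattice_iff unfolding N ball_block_index
    by (intro ball_cong refl) (simp only: lattice_entry_minus_m)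
  moreover have "Cyc (1 # map a [1..<N]) = Cyc (lattice_list N (int n)) \<longleftrightarrow>
      (\<forall>j\<in>{1..m}. \<forall>i\<in>{1..n}. a ((i - 1) * m + j) = (j - 1) * n + (n + 1 - i) + 1)"
    unfolding eq_lattice_iff unfolding N mult.commute[of m n] ball_block_index
    unfolding mult.commute[of n m] by (intro ball_cong refl) (simp only: lattice_entry_n)
  ultimately show ?thesis unfolding CC_eq_lattice[OF N] by blast
qed

theorem theorem3:
  fixes k l :: nat
  assumes "k \<ge> 1" and "l \<ge> 1"
  shows
    "(min k l \<le> 2 \<longrightarrow>
        card (CC k l) = 1 \<and>
        (k \<le> 2 \<longrightarrow> CC k l = {\<sigma> \<in> cyclic_perms {1..(k - 1) * (l - 1) + 1}. cyc_decreasing \<sigma>}) \<and>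
        (k \<ge> 3 \<longrightarrow> CC k l = {\<sigma> \<in> cyclic_perms {1..(k - 1) * (l - 1) + 1}. cyc_increasing \<sigma>})) \<and>
     (min k l \<ge> 3 \<longrightarrow>
        card (CC k l) = 2 \<and>
        (\<forall>a :: nat \<Rightarrow> nat.
          Cyc (1 # map a [1..<(k - 1) * (l - 1) + 1]) \<in> cyclic_perms {1..(k - 1) * (l - 1) + 1} \<longrightarrow>
          (Cyc (1 # map a [1..<(k - 1) * (l - 1) + 1]) \<in> CC k l \<longleftrightarrow>
            (\<forall>i\<in>{1..l - 1}. \<forall>j\<in>{1..k - 1}.
               a ((j - 1) * (l - 1) + i) = (l - 1 - i) * (k - 1) + j + 1) \<or>
            (\<forall>i\<in>{1..l - 1}. \<forall>j\<in>{1..k - 1}.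
               a ((i - 1) * (k - 1) + j) = (j - 1) * (l - 1) + (l - i) + 1))))"
proof -
  define m n where "m = k - 1" and "n = l - 1"
  then have kl: "k = m + 1" "l = n + 1" using assms by simp_all
  have decreasing: "card (CC k l) = 1" "CC k l = {\<sigma> \<in> cyclic_perms {1..m * n + 1}. cyc_decreasing \<sigma>}"
    if "k \<le> 2"
    using that CC_eq_decreasing[of m n] kl by (simp_all add: cyc_decreasing_perms_eq)
  have increasing: "card (CC k l) = 1" "CC k l = {\<sigma> \<in> cyclic_perms {1..m * n + 1}. cyc_increasing \<sigma>}"
    if "l \<le> 2"
    using that CC_eq_increasing[of n m] kl by (simp_all add: cyc_increasing_perms_eq)
  have "card (CC k l) = 2" if "min k l \<ge> 3" using that card_CC_eq_2[of m n] kl by simp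
  moreover have "min k l \<le> 2 \<longleftrightarrow> k \<le> 2 \<or> l \<le> 2" by (rule min_le_iff_disj)
  ultimately show ?thesis
    using decreasing increasing Cyc_Cons_in_CC_iff[OF refl, of _ m n]
    unfolding m_def[symmetric] n_def[symmetric] unfolding kl by auto
qed

end
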